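(* There exists a fine-grained reduction from (AE-Mono$\Delta$, $n^{2.5}$) to (sparse all-pairs PDS state reachability with stack depth at most $4\lceil \log n\rceil$, $N^{1.25}$), where $n$ is the number of vertices of the AE-Mono$\Delta$ instance and $N$ is the number of control states of the PDS.
   Context: AE-Mono$\Delta$: given an undirected graph $G=(V,E)$ on $n$ vertices with an edge coloring $c$, decide for every edge $e_{uv}$ whether there is a vertex $w$ with $e_{uw},e_{vw}\in E$ and $c(e_{uv})=c(e_{uw})=c(e_{vw})$. A push-down system (PDS) is $\mathcal{P}=(Q,\Gamma,\delta)$ with finite control states $Q$ ($N=|Q|$), finite stack alphabet $\Gamma$ and $\delta\subseteq Q\times(\Gamma\cup\{\epsilon\})\times Q\times\Gamma^*$; configurations are pairs $(q,w)\in Q\times\Gamma^*$, and the configuration graph has an edge $(q_1,w_1)\to(q_2,w_2)$ when $(q_1,\gamma,q_2,w)\in\delta$ and either $w_1=\gamma=\epsilon$, $w_2=w$, or $\gamma\neq\epsilon$, $w_1=\gamma w'$, $w_2=ww'$. All-pairs PDS state reachability asks, for all pairs $q,q'\in Q$, whether there is a path $(q,\epsilon)\to^*(q',\epsilon)$. The PDS is sparse if $|\delta|=\mathcal{O}(|Q|)$; the stack depth is the maximum stack length that can occur. For problems $P,Q$ with time bounds $t_P,t_Q$, a fine-grained reduction from $(P,t_P)$ to $(Q,t_Q)$ is an algorithm mapping an instance $I$ of $P$ to an instance $J$ of $Q$ (possibly several, in general; here one) such that the answer to $I$ is determined by the answer to $J$, for every $\epsilon>0$ there is $\delta>0$ with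 $t_Q(|J|)^{1-\epsilon}=\mathcal{O}(t_P(|I|)^{1-\delta})$, and the reduction runs in time $\mathcal{O}(t_P(|I|)^{1-\gamma})$ for some $\gamma>0$. *)

theory Defs
  imports Complex_Main "HOL-Library.Landau_Symbols" "HOL-Library.Extended_Nat"
begin

section \<open>A word RAM\<close>

text \<open>
  Running times refer to a RAM whose memory consists of finitely many zero-initialised arrays of
  natural numbers; a scalar variable is an array used at index 0 only. Every store and every test
  costs one step, which agrees with counting single operations up to a constant factor, because
  expressions are part of the fixed program text. The parameter \<open>B\<close> of the semantics is the word
  bound: a store whose address or value is not below \<open>B\<close> blocks, so such a program has no run.
\<close>

datatype expr =
    Const nat
  | Read nat expr
  | Add expr expr
  | Sub expr expr
  | Mul expr expr
  | Div expr expr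
  | Mod expr expr

datatype test =
    Less expr expr
  | Equal expr expr
  | Neg test
  | Conj test test

datatype com =
    Skip
  | Store nat expr expr
  | Seq com com
  | Cond test com com
  | While test com

type_synonym memory = "nat \<Rightarrow> nat \<Rightarrow> nat"

fun eval :: "expr \<Rightarrow> memory \<Rightarrow> nat" where
  "eval (Const k) s = k"
| "eval (Read a e) s = s a (eval e s)"
| "eval (Add e e') s = eval e s + eval e' s"
| "eval (Sub e e') s = eval e s - eval e' s"
| "eval (Mul e e') s = eval e s * eval e' s"
| "eval (Div e e') s = eval e s div eval e' s"
| "eval (Mod e e') s = eval e s mod eval e' s"

fun test_holds :: "test \<Rightarrow> memory \<Rightarrow> bool" where
  "test_holds (Less e e') s \<longleftrightarrow> eval e s < eval e' s"
| "test_holds (Equal e e') s \<longleftrightarrow> eval e s = eval e' s"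
| "test_holds (Neg b) s \<longleftrightarrow> \<not> test_holds b s"
| "test_holds (Conj b b') s \<longleftrightarrow> test_holds b s \<and> test_holds b' s"

text \<open>\<open>exec B c s t s'\<close>: started in memory \<open>s\<close>, command \<open>c\<close> halts after \<open>t\<close> steps in memory \<open>s'\<close>.\<close>

inductive exec :: "nat \<Rightarrow> com \<Rightarrow> memory \<Rightarrow> nat \<Rightarrow> memory \<Rightarrow> bool" for B :: nat where
  Skip: "exec B Skip s 1 s"
| Store: "eval i s < B \<Longrightarrow> eval e s < B \<Longrightarrow>
    exec B (Store a i e) s 1 (s(a := (s a)(eval i s := eval e s)))"
| Seq: "exec B c s t s' \<Longrightarrow> exec B d s' u s'' \<Longrightarrow> exec B (Seq c d) s (t + u) s''"
| CondTrue: "test_holds b s \<Longrightarrow> exec B c s t s' \<Longrightarrow> exec B (Cond b c d) s (Suc t) s'"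
| CondFalse: "\<not> test_holds b s \<Longrightarrow> exec B d s t s' \<Longrightarrow> exec B (Cond b c d) s (Suc t) s'"
| WhileFalse: "\<not> test_holds b s \<Longrightarrow> exec B (While b c) s 1 s"
| WhileTrue: "test_holds b s \<Longrightarrow> exec B c s t s' \<Longrightarrow> exec B (While b c) s' u s'' \<Longrightarrow>
    exec B (While b c) s (Suc (t + u)) s''"

lemma exec_deterministic:
  "exec B c s t s' \<Longrightarrow> exec B c s u s'' \<Longrightarrow> u = t \<and> s'' = s'"
proof (induction arbitrary: u s'' rule: exec.induct)
  case (Skip s)
  then show ?case by cases simp
next
  case (Store i s e a)
  from Store.prems show ?case by cases iprover
next
  case (Seq c s t s' d u' s2)
  from Seq.prems show ?case by cases (metis Seq.IH)
next
  case (CondTrue b s c t s' d)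
  from CondTrue.prems CondTrue.hyps show ?case by cases (simp_all add: CondTrue.IH)
next
  case (CondFalse b s d t s' c)
  from CondFalse.prems CondFalse.hyps show ?case by cases (simp_all add: CondFalse.IH)
next
  case (WhileFalse b s c)
  from WhileFalse.prems WhileFalse.hyps show ?case by cases simp_all
next
  case (WhileTrue b s c t s' u' s2)
  from WhileTrue.prems show ?case by cases (use WhileTrue.hyps WhileTrue.IH in metis)+
qed

definition input_memory :: "nat list \<Rightarrow> memory" where
  "input_memory xs = (\<lambda>a i. if a = 0 \<and> i < length xs then xs ! i else 0)"

definition holds_list :: "(nat \<Rightarrow> nat) \<Rightarrow> nat list \<Rightarrow> bool" where
  "holds_list m xs \<longleftrightarrow> (\<forall>i < length xs. m i = xs ! i)"

text \<open>
  Words of \<open>k\<close> times the bit length of the input length and of the largest input number. For inputs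
  of polynomially bounded numbers these are the usual words of logarithmic length.
\<close>

definition word_bound :: "nat \<Rightarrow> nat list \<Rightarrow> nat" where
  "word_bound k xs = (2 + length xs + Max (insert 0 (set xs))) ^ k"


section \<open>Problems and fine-grained reductions\<close>

text \<open>
  A problem asks for a yes/no answer to each of the index pairs in \<open>queries I\<close>.
  \<open>codes I xs\<close> says that the word sequence \<open>xs\<close> represents the instance \<open>I\<close>.
\<close>

record 'i problem =
  instances :: "'i set"
  inst_size :: "'i \<Rightarrow> nat"
  codes :: "'i \<Rightarrow> nat list \<Rightarrow> bool"
  queries :: "'i \<Rightarrow> (nat \<times> nat) set"
  answer :: "'i \<Rightarrow> nat \<times> nat \<Rightarrow> bool"

text \<open>Answers are handed over as a bit matrix in row-major order.\<close>

definition answer_table :: "'i problem \<Rightarrow> 'i \<Rightarrow> (nat \<Rightarrow> nat) \<Rightarrow> bool" where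
  "answer_table P I m \<longleftrightarrow>
    (\<forall>(x, y) \<in> queries P I. m (x * inst_size P I + y) = of_bool (answer P I (x, y)))"

text \<open>Big-O over this filter: uniformly in all instances, as the instance size tends to infinity.\<close>

definition growing :: "'i problem \<Rightarrow> 'i filter" where
  "growing P = inf (filtercomap (inst_size P) at_top) (principal (instances P))"

text \<open>
  The reduction consists of a program \<open>prep\<close>, which reads a code of \<open>I\<close> in array 0 and leaves a code
  of \<open>f I\<close> in array 1, and a program \<open>post\<close>, which continues with the answers to \<open>f I\<close> supplied in
  array 2 and leaves the answers to \<open>I\<close> in array 3. Thus the answer to \<open>I\<close> is not merely a function
  of the answer to \<open>f I\<close>: it is recovered within the time of the reduction. An arbitrary function
  would make the notion vacuous, as \<open>f I\<close> could spell out \<open>I\<close> in its answer.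
\<close>

definition computes_reduction ::
    "com \<Rightarrow> com \<Rightarrow> nat \<Rightarrow> 'i problem \<Rightarrow> 'j problem \<Rightarrow> ('i \<Rightarrow> 'j) \<Rightarrow> ('i \<Rightarrow> nat) \<Rightarrow> bool" where
  "computes_reduction prep post k P Q f time \<longleftrightarrow>
    (\<forall>I \<in> instances P. \<forall>xs. codes P I xs \<longrightarrow>
      (\<exists>t s ys. exec (word_bound k xs) prep (input_memory xs) t s \<and>
        codes Q (f I) ys \<and> holds_list (s 1) ys \<and>
        (\<forall>m. answer_table Q (f I) m \<longrightarrow>
          (\<exists>t' s'. exec (word_bound k xs) post (s(2 := m)) t' s' \<and>
            answer_table P I (s' 3) \<and> t + t' \<le> time I))))"

definition fine_grained_reduction ::
    "'i problem \<Rightarrow> (nat \<Rightarrow> real) \<Rightarrow> 'j problem \<Rightarrow> (nat \<Rightarrow> real) \<Rightarrow> ('i \<Rightarrow> 'j) \<Rightarrow> bool" where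
  "fine_grained_reduction P tP Q tQ f \<longleftrightarrow>
    (\<forall>I \<in> instances P. f I \<in> instances Q) \<and>
    (\<forall>\<epsilon>>0. \<exists>\<delta>>0. (\<lambda>I. tQ (inst_size Q (f I)) powr (1 - \<epsilon>))
        \<in> O[growing P](\<lambda>I. tP (inst_size P I) powr (1 - \<delta>))) \<and>
    (\<exists>prep post k time. \<exists>\<gamma>>0. computes_reduction prep post k P Q f time \<and>
        (\<lambda>I. real (time I)) \<in> O[growing P](\<lambda>I. tP (inst_size P I) powr (1 - \<gamma>)))"


section \<open>All-edges monochromatic triangle\<close>

text \<open>Only the colors of edges matter.\<close>

record colored_graph =
  order :: nat
  edges :: "nat set set"
  color :: "nat set \<Rightarrow> nat"

definition wf_graph :: "colored_graph \<Rightarrow> bool" where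
  "wf_graph G \<longleftrightarrow> (\<forall>e \<in> edges G. e \<subseteq> {..<order G} \<and> card e = 2)"

definition in_mono_triangle :: "colored_graph \<Rightarrow> nat \<times> nat \<Rightarrow> bool" where
  "in_mono_triangle G = (\<lambda>(u, v). \<exists>w < order G. {u, w} \<in> edges G \<and> {v, w} \<in> edges G \<and>
     color G {u, v} = color G {u, w} \<and> color G {u, w} = color G {v, w})"

text \<open>The number of vertices, then the adjacency matrix: 0 for a non-edge, 1 + color for an edge.\<close>

definition graph_code :: "colored_graph \<Rightarrow> nat list" where
  "graph_code G = order G #
     concat (map (\<lambda>u. map (\<lambda>v. if {u, v} \<in> edges G then Suc (color G {u, v}) else 0)
       [0..<order G]) [0..<order G])"

definition ae_mono_triangle :: "colored_graph problem" where
  "ae_mono_triangle =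
    \<lparr>instances = {G. wf_graph G},
     inst_size = order,
     codes = (\<lambda>G xs. xs = graph_code G),
     queries = (\<lambda>G. {(u, v). {u, v} \<in> edges G}),
     answer = in_mono_triangle\<rparr>"


section \<open>All-pairs state reachability in push-down systems\<close>

text \<open>In a rule, \<open>None\<close> stands for the empty word in the position of the symbol read.\<close>

record ('q, 'g) pds =
  states :: "'q set"
  alphabet :: "'g set"
  rules :: "('q \<times> 'g option \<times> 'q \<times> 'g list) set"

definition wf_pds :: "('q, 'g) pds \<Rightarrow> bool" where
  "wf_pds P \<longleftrightarrow> finite (states P) \<and> finite (alphabet P) \<and> finite (rules P) \<and>
    rules P \<subseteq> states P \<times> insert None (Some ` alphabet P) \<times> states P \<times> lists (alphabet P)"

text \<open>The top of the stack is the head of the list; a rule reading \<open>None\<close> needs an empty stack.\<close>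

inductive step :: "('q, 'g) pds \<Rightarrow> 'q \<times> 'g list \<Rightarrow> 'q \<times> 'g list \<Rightarrow> bool" for P where
  empty: "(q, None, q', w) \<in> rules P \<Longrightarrow> step P (q, []) (q', w)"
| top: "(q, Some g, q', w) \<in> rules P \<Longrightarrow> v \<in> lists (alphabet P) \<Longrightarrow> step P (q, g # v) (q', w @ v)"

definition state_reachable :: "('q, 'g) pds \<Rightarrow> 'q \<times> 'q \<Rightarrow> bool" where
  "state_reachable P = (\<lambda>(q, q'). (step P)\<^sup>*\<^sup>* (q, []) (q', []))"

definition stack_depth :: "('q, 'g) pds \<Rightarrow> enat" where
  "stack_depth P = Sup {enat (length w) | w q q'. q \<in> states P \<and> (step P)\<^sup>*\<^sup>* (q, []) (q', w)}"

definition sparse :: "nat \<Rightarrow> ('q, 'g) pds \<Rightarrow> bool" where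
  "sparse K P \<longleftrightarrow> card (rules P) \<le> K * card (states P)"

fun rule_code :: "nat \<times> nat option \<times> nat \<times> nat list \<Rightarrow> nat list" where
  "rule_code (q, g, q', w) = [q, case g of None \<Rightarrow> 0 | Some a \<Rightarrow> Suc a, q', length w] @ w"

text \<open>
  As inputs to algorithms, push-down systems have states and symbols numbered from 0. The code gives
  these two numbers and lists the rules without repetition in any order.
\<close>

definition pds_code :: "(nat, nat) pds \<Rightarrow> nat list \<Rightarrow> bool" where
  "pds_code P xs \<longleftrightarrow> (\<exists>rs. distinct rs \<and> set rs = rules P \<and>
     xs = [card (states P), card (alphabet P), length rs] @ concat (map rule_code rs))"

definition sparse_pds_reachability :: "nat \<Rightarrow> (nat, nat) pds problem" where
  "sparse_pds_reachability K =
    \<lparr>instances = {P. wf_pds P \<and> sparse K P \<and>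
       states P = {..<card (states P)} \<and> alphabet P = {..<card (alphabet P)}},
     inst_size = (\<lambda>P. card (states P)),
     codes = pds_code,
     queries = (\<lambda>P. states P \<times> states P),
     answer = state_reachable\<rparr>"

end

theory Submission
  imports Defs
begin

text \<open>
  An edge \<open>{u, v}\<close> of color \<open>c\<close> lies in a monochromatic triangle iff there is a path \<open>u, w, v\<close> both of
  whose edges have color \<open>c\<close>. The push-down system has a state for each pair \<open>(u, v)\<close> and three
  copies of the vertex set. From the state of the pair \<open>(u, v)\<close> it pushes \<open>c\<close> twice and moves to \<open>u\<close>
  in the first copy; every edge then leads from each copy to the next while popping its own color.
  So \<open>v\<close> in the third copy is reached with empty stack iff the triangle exists. There are
  \<open>n\<^sup>2 + 3 n\<close> states and at most \<open>3 n\<^sup>2\<close> rules. As colors serve as stack symbols, depth 2 suffices.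
\<close>

section \<open>Total correctness with time bounds\<close>

text \<open>As \<open>exec\<close> is deterministic, one halting run within the budget amounts to
  total correctness. An oversized store has no run, so \<open>runs\<close> also certifies that all
  stored words and addresses stay below \<open>B\<close>.\<close>

definition runs :: "nat \<Rightarrow> com \<Rightarrow> memory \<Rightarrow> nat \<Rightarrow> (memory \<Rightarrow> bool) \<Rightarrow> bool" where
  "runs B c s T Q \<longleftrightarrow> (\<exists>t s'. exec B c s t s' \<and> t \<le> T \<and> Q s')"

lemma runs_mono:
  assumes "runs B c s T Q" "T \<le> T'" "\<And>s'. Q s' \<Longrightarrow> Q' s'"
  shows "runs B c s T' Q'"
  using assms unfolding runs_def by (meson le_trans)

lemma runs_Skip: "1 \<le> T \<Longrightarrow> Q s \<Longrightarrow> runs B Skip s T Q"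
  unfolding runs_def by (meson exec.Skip)

lemma runs_Store:
  assumes "eval i s < B" "eval e s < B" "1 \<le> T" "Q (s(a := (s a)(eval i s := eval e s)))"
  shows "runs B (Store a i e) s T Q"
  unfolding runs_def using assms exec.Store by blast

lemma runs_Seq:
  assumes "runs B c s T (\<lambda>s'. runs B d s' U Q)" "T + U \<le> V"
  shows "runs B (Seq c d) s V Q"
proof -
  obtain t s' u s'' where "exec B c s t s'" "t \<le> T" "exec B d s' u s''" "u \<le> U" "Q s''"
    using assms(1) unfolding runs_def by blast
  then show ?thesis
    unfolding runs_def using assms(2) by (intro exI[of _ "t + u"] exI[of _ s'']) (auto intro: exec.Seq)
qed

lemma runs_Cond:
  assumes "test_holds b s \<Longrightarrow> runs B c s T Q" "\<not> test_holds b s \<Longrightarrow> runs B d s T Q" "Suc T \<le> U"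
  shows "runs B (Cond b c d) s U Q"
proof (cases "test_holds b s")
  case True
  then obtain t s' where "exec B c s t s'" "t \<le> T" "Q s'"
    using assms(1) unfolding runs_def by blast
  then show ?thesis
    unfolding runs_def using assms(3) True
    by (intro exI[of _ "Suc t"] exI[of _ s']) (auto intro: exec.CondTrue)
next
  case False
  then obtain t s' where "exec B d s t s'" "t \<le> T" "Q s'"
    using assms(2) unfolding runs_def by blast
  then show ?thesis
    unfolding runs_def using assms(3) False
    by (intro exI[of _ "Suc t"] exI[of _ s']) (auto intro: exec.CondFalse)
qed

text \<open>All loops here are counted, so the invariant carries the iteration number and serves as
  its own variant. A round costs its body plus one test; the final \<open>+ 1\<close> is the failing
  test.\<close>

lemma runs_While:
  assumes "i \<le> m" "Inv i s"
    and body: "\<And>j s. j < m \<Longrightarrow> Inv j s \<Longrightarrow> test_holds b s \<and> runs B c s T (Inv (Suc j))"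
    and exit: "\<And>s. Inv m s \<Longrightarrow> \<not> test_holds b s"
  shows "runs B (While b c) s ((m - i) * Suc T + 1) (Inv m)"
  using assms(1,2)
proof (induction "m - i" arbitrary: i s)
  case 0
  then show ?case
    unfolding runs_def using exit by (auto intro!: exI exec.WhileFalse)
next
  case (Suc k)
  then have "i < m" by simp
  with Suc.prems body obtain t s' where b: "test_holds b s" "exec B c s t s'" "t \<le> T" "Inv (Suc i) s'"
    unfolding runs_def by blast
  moreover have "runs B (While b c) s' ((m - Suc i) * Suc T + 1) (Inv m)"
    by (rule Suc.hyps(1)) (use Suc.hyps(2) \<open>i < m\<close> b(4) in auto)
  then obtain u s'' where u: "exec B (While b c) s' u s''" "u \<le> (m - Suc i) * Suc T + 1" "Inv m s''"
    unfolding runs_def by blast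
  ultimately have "exec B (While b c) s (Suc (t + u)) s''"
    by (auto intro: exec.WhileTrue)
  moreover have "m - i = Suc (m - Suc i)"
    using \<open>i < m\<close> by simp
  then have "Suc (t + u) \<le> (m - i) * Suc T + 1"
    using u(2) \<open>t \<le> T\<close> by simp
  ultimately show ?case
    unfolding runs_def using u(3) by blast
qed

section \<open>Writing word sequences\<close>

abbreviation scalar :: "nat \<Rightarrow> expr" where
  "scalar a \<equiv> Read a (Const 0)"

abbreviation assign :: "nat \<Rightarrow> expr \<Rightarrow> com" where
  "assign a e \<equiv> Store a (Const 0) e"

text \<open>Appends to the word sequence in array 1, whose length is kept in array 5.\<close>

fun emit :: "expr list \<Rightarrow> com" where
  "emit [] = Skip"
| "emit (e # es) =
    Seq (Store 1 (scalar 5) e) (Seq (assign 5 (Add (scalar 5) (Const 1))) (emit es))"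

definition written :: "memory \<Rightarrow> nat list \<Rightarrow> bool" where
  "written s ys \<longleftrightarrow> s 5 0 = length ys \<and> holds_list (s 1) ys"

lemma holds_list_snoc:
  "holds_list m ys \<Longrightarrow> holds_list (m(length ys := x)) (ys @ [x])"
  by (auto simp: holds_list_def nth_append less_Suc_eq)

text \<open>Later expressions are evaluated after arrays 1 and 5 have changed. Hence the values are
  required in every memory that agrees with \<open>s\<close> elsewhere. The budget is two stores per
  word and the closing \<open>Skip\<close>.\<close>

lemma runs_emit:
  assumes "written s ys" "length ys + length xs < B" "\<forall>x \<in> set xs. x < B"
    and "\<And>s'. (\<And>a. a \<noteq> 1 \<Longrightarrow> a \<noteq> 5 \<Longrightarrow> s' a = s a) \<Longrightarrow> map (\<lambda>e. eval e s') es = xs"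
  shows "runs B (emit es) s (2 * length es + 1)
    (\<lambda>s'. written s' (ys @ xs) \<and> (\<forall>a. a \<noteq> 1 \<longrightarrow> a \<noteq> 5 \<longrightarrow> s' a = s a))"
  using assms
proof (induction es arbitrary: s ys xs)
  case Nil
  then have "xs = []" by fastforce
  with Nil show ?case by (auto intro: runs_Skip)
next
  case (Cons e es)
  obtain x xs' where xs: "xs = x # xs'"
    using Cons.prems(4)[of s] by auto
  have val: "eval e s' = x" "map (\<lambda>e. eval e s') es = xs'"
    if "\<And>a. a \<noteq> 1 \<Longrightarrow> a \<noteq> 5 \<Longrightarrow> s' a = s a" for s'
    using Cons.prems(4)[of s'] that xs by auto
  define s1 where "s1 = s(1 := (s 1)(length ys := x))"
  define s2 where "s2 = s1(5 := (s1 5)(0 := Suc (length ys)))"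
  have s2: "s2 a = s a" if "a \<noteq> 1" "a \<noteq> 5" for a
    using that by (simp add: s2_def s1_def)
  have pos: "s 5 0 = length ys" "s1 5 0 = length ys"
    using Cons.prems(1) by (auto simp: written_def s1_def)
  have w: "written s2 (ys @ [x])"
    using Cons.prems(1) holds_list_snoc[of "s 1" ys x] by (simp add: written_def s2_def s1_def)
  have "runs B (emit es) s2 (2 * length es + 1)
      (\<lambda>s'. written s' ((ys @ [x]) @ xs') \<and> (\<forall>a. a \<noteq> 1 \<longrightarrow> a \<noteq> 5 \<longrightarrow> s' a = s2 a))"
    by (rule Cons.IH[OF w]) (use Cons.prems(2,3) xs val(2) s2 in auto)
  then have "runs B (emit es) s2 (2 * length es + 1)
      (\<lambda>s'. written s' (ys @ xs) \<and> (\<forall>a. a \<noteq> 1 \<longrightarrow> a \<noteq> 5 \<longrightarrow> s' a = s a))"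
    by (rule runs_mono) (auto simp: xs s2)
  then have rest: "runs B (Seq (assign 5 (Add (scalar 5) (Const 1))) (emit es)) s1 (2 * length es + 2)
      (\<lambda>s'. written s' (ys @ xs) \<and> (\<forall>a. a \<noteq> 1 \<longrightarrow> a \<noteq> 5 \<longrightarrow> s' a = s a))"
    by (intro runs_Seq[where T = 1] runs_Store)
      (use Cons.prems(2) in \<open>auto simp: pos s2_def xs\<close>)
  show ?case
    unfolding emit.simps
    by (rule runs_Seq[where T = 1 and U = "2 * length es + 2", OF runs_Store])
      (use rest Cons.prems(2,3) val(1)[of s] in \<open>auto simp: pos s1_def xs\<close>)
qed


section \<open>The push-down system of a colored graph\<close>

text \<open>The pair \<open>(u, v)\<close> of vertices is numbered \<open>u * order G + v\<close>, as in the adjacency matrix.\<close>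

definition matrix_entry :: "colored_graph \<Rightarrow> nat \<Rightarrow> nat" where
  "matrix_entry G i = (let e = {i div order G, i mod order G} in
    if e \<in> edges G then Suc (color G e) else 0)"

text \<open>Vertex \<open>u\<close> has number \<open>k * n + u\<close> in copy \<open>k\<close> =
  0, 1, 2, and the pair states start at \<open>3 * n\<close>. Every edge occurs as both ordered
  pairs, so it can be traversed in both directions.\<close>

definition edge_rules :: "colored_graph \<Rightarrow> nat \<Rightarrow> (nat \<times> nat option \<times> nat \<times> nat list) list" where
  "edge_rules G i = (let n = order G; u = i div n; v = i mod n; c = color G {u, v} in
    if {u, v} \<in> edges G
    then [(3 * n + i, None, u, [c, c]), (u, Some c, n + v, []), (n + u, Some c, 2 * n + v, [])]
    else [])"

text \<open>Prefixes are needed for the loop invariant: this is what has been written after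
  \<open>m\<close> matrix entries.\<close>

definition first_rules :: "colored_graph \<Rightarrow> nat \<Rightarrow> (nat \<times> nat option \<times> nat \<times> nat list) list" where
  "first_rules G m = concat (map (edge_rules G) [0..<m])"

text \<open>The sum of all matrix entries serves as an upper bound on the colors that is easy to compute.\<close>

definition triangle_pds :: "colored_graph \<Rightarrow> (nat, nat) pds" where
  "triangle_pds G = (let n = order G in
    \<lparr>states = {..<3 * n + n * n},
     alphabet = {..<\<Sum>i<n * n. matrix_entry G i},
     rules = set (first_rules G (n * n))\<rparr>)"

lemma triangle_pds_simps [simp]:
  "states (triangle_pds G) = {..<3 * order G + order G * order G}"
  "alphabet (triangle_pds G) = {..<\<Sum>i<order G * order G. matrix_entry G i}"
  "rules (triangle_pds G) = set (first_rules G (order G * order G))"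
  by (simp_all add: triangle_pds_def Let_def)

lemma first_rules_0 [simp]: "first_rules G 0 = []"
  by (simp add: first_rules_def)

lemma first_rules_Suc: "first_rules G (Suc m) = first_rules G m @ edge_rules G m"
  by (simp add: first_rules_def)

section \<open>Membership in the rules, well-formedness, absence of repetitions\<close>

lemma pair_number_less:
  fixes u v n :: nat
  assumes "u < n" "v < n"
  shows "u * n + v < n * n"
proof -
  have "u * n + v < Suc u * n" using assms by simp
  also have "\<dots> \<le> n * n" using assms by (intro mult_right_mono) auto
  finally show ?thesis .
qed

lemma pair_of_number:
  fixes i n :: nat
  assumes "i < n * n"
  shows "i div n < n" "i mod n < n"
  using assms by (cases "n = 0"; simp add: less_mult_imp_div_less)+

lemma wf_graph_edgeD:
  assumes "wf_graph G" "{u, v} \<in> edges G"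
  shows "u < order G" "v < order G" "u \<noteq> v"
  using assms by (fastforce simp: wf_graph_def)+

text \<open>Trades pair numbers for edges \<open>{u, v}\<close>; well-formedness keeps both ends
  below \<open>order G\<close>, so no edge is missed by the enumeration.\<close>

lemma rules_triangle_pds_iff:
  assumes "wf_graph G"
  shows "r \<in> rules (triangle_pds G) \<longleftrightarrow>
    (\<exists>u v. {u, v} \<in> edges G \<and> (let n = order G; c = color G {u, v} in
      r = (3 * n + (u * n + v), None, u, [c, c]) \<or> r = (u, Some c, n + v, []) \<or>
      r = (n + u, Some c, 2 * n + v, [])))"
    (is "_ \<longleftrightarrow> (\<exists>u v. ?R u v)")
proof
  assume "r \<in> rules (triangle_pds G)"
  then obtain i where i: "i < order G * order G" "r \<in> set (edge_rules G i)"
    by (auto simp: first_rules_def)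
  then have "?R (i div order G) (i mod order G)"
    by (auto simp: edge_rules_def Let_def split: if_splits)
  then show "\<exists>u v. ?R u v" by blast
next
  assume "\<exists>u v. ?R u v"
  then obtain u v where *: "?R u v" by blast
  with assms have uv: "u < order G" "v < order G"
    using wf_graph_edgeD by blast+
  then have "r \<in> set (edge_rules G (u * order G + v))"
    using * by (auto simp: edge_rules_def Let_def)
  then show "r \<in> rules (triangle_pds G)"
    using pair_number_less[OF uv] by (auto simp: first_rules_def)
qed

text \<open>The successor of the color is itself one of the summands that make up the alphabet
  size.\<close>

lemma color_less_alphabet:
  assumes "wf_graph G" "{u, v} \<in> edges G"
  shows "color G {u, v} < (\<Sum>i<order G * order G. matrix_entry G i)"
proof -
  note uv = wf_graph_edgeD[OF assms]
  have "Suc (color G {u, v}) = matrix_entry G (u * order G + v)"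
    using uv assms by (auto simp: matrix_entry_def Let_def)
  also have "\<dots> \<le> (\<Sum>i<order G * order G. matrix_entry G i)"
    using pair_number_less[OF uv(1,2)] by (intro member_le_sum) auto
  finally show ?thesis by simp
qed

lemma wf_triangle_pds:
  assumes "wf_graph G"
  shows "wf_pds (triangle_pds G)"
proof -
  have "r \<in> states (triangle_pds G) \<times> insert None (Some ` alphabet (triangle_pds G)) \<times>
      states (triangle_pds G) \<times> lists (alphabet (triangle_pds G))"
    if "r \<in> rules (triangle_pds G)" for r
    using that assms wf_graph_edgeD[OF assms] color_less_alphabet[OF assms] pair_number_less
    unfolding rules_triangle_pds_iff[OF assms] Let_def
    by (fastforce simp: trans_less_add1)
  then show ?thesis
    unfolding wf_pds_def by (intro conjI subsetI) simp_all
qed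

lemma length_first_rules_le: "length (first_rules G m) \<le> 3 * m"
  by (induction m) (auto simp: first_rules_Suc edge_rules_def Let_def)

text \<open>A pushing rule has \<open>i\<close> in its source. A popping rule shows \<open>u\<close>
  in its source and \<open>v\<close> in its target, and the ranges of the copies tell the two kinds
  apart. This is what makes the written list free of repetitions, as \<open>pds_code\<close>
  demands.\<close>

lemma edge_rules_disjoint:
  assumes "r \<in> set (edge_rules G i)" "r \<in> set (edge_rules G j)"
    and "i < order G * order G" "j < order G * order G"
  shows "i = j"
proof -
  note * = pair_of_number[OF assms(3)] pair_of_number[OF assms(4)]
  have "i = j \<or> i div order G = j div order G \<and> i mod order G = j mod order G"
    using assms(1,2) * by (auto simp: edge_rules_def Let_def split: if_splits)
  then show ?thesis by (metis div_mult_mod_eq)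
qed

lemma distinct_edge_rules: "i < order G * order G \<Longrightarrow> distinct (edge_rules G i)"
  using pair_of_number[of i "order G"] by (auto simp: edge_rules_def Let_def)

lemma distinct_first_rules: "m \<le> order G * order G \<Longrightarrow> distinct (first_rules G m)"
proof (induction m)
  case (Suc m)
  then have "set (first_rules G m) \<inter> set (edge_rules G m) = {}"
    using edge_rules_disjoint[of _ G _ m] by (fastforce simp: first_rules_def)
  with Suc show ?case by (simp add: first_rules_Suc distinct_edge_rules)
qed simp

section \<open>Runs of the push-down system and monochromatic triangles\<close>

lemma step_triangle_pds_iff:
  assumes "wf_graph G"
  shows "step (triangle_pds G) (q, l) (q', l') \<longleftrightarrow>
    (\<exists>u v. {u, v} \<in> edges G \<and> (let n = order G; c = color G {u, v} in
      q = 3 * n + (u * n + v) \<and> l = [] \<and> q' = u \<and> l' = [c, c] \<or>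
      l = c # l' \<and> l' \<in> lists (alphabet (triangle_pds G)) \<and>
        (q = u \<and> q' = n + v \<or> q = n + u \<and> q' = 2 * n + v)))"
    (is "_ \<longleftrightarrow> ?R")
proof
  show ?R if "step (triangle_pds G) (q, l) (q', l')"
    using that
  proof cases
    case empty
    then show ?thesis
      unfolding rules_triangle_pds_iff[OF assms] Let_def by blast
  next
    case (top g w v)
    then show ?thesis
      unfolding rules_triangle_pds_iff[OF assms] Let_def by fastforce
  qed
  show "step (triangle_pds G) (q, l) (q', l')" if ?R
  proof -
    obtain u v where uv: "{u, v} \<in> edges G" and
      "q = 3 * order G + (u * order G + v) \<and> l = [] \<and> q' = u \<and> l' = [color G {u, v}, color G {u, v}] \<or>
        l = color G {u, v} # l' \<and> l' \<in> lists (alphabet (triangle_pds G)) \<and>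
        (q = u \<and> q' = order G + v \<or> q = order G + u \<and> q' = 2 * order G + v)" (is "?A \<or> ?B")
      using \<open>?R\<close> unfolding Let_def by blast
    from this(2) show ?thesis
    proof
      assume ?A
      then have "(q, None, q', l') \<in> rules (triangle_pds G)"
        using uv unfolding rules_triangle_pds_iff[OF assms] Let_def by blast
      with \<open>?A\<close> show ?thesis by (metis step.empty)
    next
      assume ?B
      then have "(q, Some (color G {u, v}), q', []) \<in> rules (triangle_pds G)"
        using uv unfolding rules_triangle_pds_iff[OF assms] Let_def by blast
      with \<open>?B\<close> step.top[OF this, of l'] show ?thesis by simp
    qed
  qed
qed

text \<open>The invariant lists all configurations reachable from the pair state. It is closed
  because the third copy is a dead end: rules start below \<open>2 * n\<close> or from
  \<open>3 * n\<close> on.\<close>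

lemma sound_triangle_pds:
  assumes wf: "wf_graph G" and uv: "{u, v} \<in> edges G"
    and reach: "state_reachable (triangle_pds G) (3 * order G + (u * order G + v), 2 * order G + v)"
  shows "in_mono_triangle G (u, v)"
proof -
  define n where "n = order G"
  define c where "c = color G {u, v}"
  define adj where "adj x y \<longleftrightarrow> {x, y} \<in> edges G \<and> color G {x, y} = c" for x y
  note lt = wf_graph_edgeD(1,2)[OF wf, folded n_def]
  have inv: "x = (3 * n + (u * n + v), []) \<or> x = (u, [c, c]) \<or>
      (\<exists>w. adj u w \<and> x = (n + w, [c])) \<or> (\<exists>w y. adj u w \<and> adj w y \<and> x = (2 * n + y, []))"
    if "(step (triangle_pds G))\<^sup>*\<^sup>* (3 * n + (u * n + v), []) x" for x
    using that
  proof (induction rule: rtranclp_induct)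
    case (step x y)
    obtain q l q' l' where xy: "x = (q, l)" "y = (q', l')" by (cases x, cases y) auto
    obtain a b where ab: "{a, b} \<in> edges G" "a < n" "b < n"
      and st: "q = 3 * n + (a * n + b) \<and> l = [] \<and> q' = a \<and> l' = [color G {a, b}, color G {a, b}] \<or>
        l = color G {a, b} # l' \<and> (q = a \<and> q' = n + b \<or> q = n + a \<and> q' = 2 * n + b)"
      using step.hyps(2) lt unfolding xy step_triangle_pds_iff[OF wf] Let_def n_def by blast
    \<comment> \<open>Quotient and remainder by \<open>n\<close> recover the pair, so the two
      symbols pushed are the color of \<open>{u, v}\<close> itself.\<close>
    have "a = u \<and> b = v" if "a * n + b = u * n + v"
      using that ab(3) lt(2)[OF uv] by (metis div_mult_self3 div_less add.right_neutral
          gr_implies_not0 mod_less mod_mult_self3)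
    note start = this
    have adj: "w < n" if "adj x w" for x w
      using that lt by (auto simp: adj_def)
    consider "q = 3 * n + (u * n + v)" "l = []" | "q = u" "l = [c, c]"
      | w where "adj u w" "q = n + w" "l = [c]" | w z where "adj u w" "adj w z" "q = 2 * n + z" "l = []"
      using step.IH unfolding xy by blast
    then show ?case
    proof cases
      case 1
      then have "a * n + b = u * n + v" "l' = [color G {a, b}, color G {a, b}]" "q' = a"
        using st by auto
      with start show ?thesis by (auto simp: xy c_def)
    next
      case 2
      then have "q' = n + b" "a = u" "l' = [c]" "color G {a, b} = c"
        using st ab lt[OF uv] by auto
      with ab show ?thesis by (auto simp: xy adj_def)
    next
      case (3 w)
      then have "q' = 2 * n + b" "a = w" "l' = []" "color G {a, b} = c"
        using st ab adj by auto
      with ab 3 show ?thesis by (auto simp: xy adj_def)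
    next
      case (4 w z)
      then have False
        using st ab adj by auto
      then show ?thesis ..
    qed
  qed simp
  \<comment> \<open>The empty stack and the state number leave only the last case of the invariant,
    with \<open>y = v\<close>.\<close>
  obtain w where w: "adj u w" "adj w v"
    using inv reach lt[OF uv] unfolding state_reachable_def n_def[symmetric] by fastforce
  moreover have "w < n"
    using w(1) lt unfolding adj_def by blast
  moreover have "{w, v} = {v, w}" by auto
  ultimately show ?thesis
    unfolding in_mono_triangle_def by (auto simp: adj_def c_def n_def)
qed

lemma complete_triangle_pds:
  assumes wf: "wf_graph G" and uv: "{u, v} \<in> edges G" and "in_mono_triangle G (u, v)"
  shows "state_reachable (triangle_pds G) (3 * order G + (u * order G + v), 2 * order G + v)"
proof -
  define n where "n = order G"
  define c where "c = color G {u, v}"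
  have "{w, v} = {v, w}" for w by auto
  with assms(3) obtain w where
    w: "{u, w} \<in> edges G" "{w, v} \<in> edges G" "color G {u, w} = c" "color G {w, v} = c"
    by (auto simp: in_mono_triangle_def c_def)
  \<comment> \<open>After the first pop the rest of the stack is \<open>[c]\<close>, which
    \<open>step\<close> requires to be a word over the alphabet.\<close>
  have c: "c \<in> alphabet (triangle_pds G)"
    using color_less_alphabet[OF wf uv] by (simp add: c_def)
  have "step (triangle_pds G) (3 * n + (u * n + v), []) (u, [c, c])"
    using uv unfolding step_triangle_pds_iff[OF wf] Let_def n_def c_def by blast
  moreover have "step (triangle_pds G) (u, [c, c]) (n + w, [c])"
    using w c unfolding step_triangle_pds_iff[OF wf] Let_def n_def by fastforce
  moreover have "step (triangle_pds G) (n + w, [c]) (2 * n + v, [])"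
    using w unfolding step_triangle_pds_iff[OF wf] Let_def n_def by fastforce
  ultimately show ?thesis
    unfolding state_reachable_def n_def[symmetric] prod.case
    by (meson converse_rtranclp_into_rtranclp rtranclp.rtrancl_refl)
qed

section \<open>Stack depth\<close>

text \<open>For at least two vertices the logarithm is at least 1, so depth 2 is within the bound.
  For fewer vertices the bound is 0 (with the convention that the logarithm of 0 is 0), but then
  there are no edges and hence no steps.\<close>

lemma reachable_stack_bound:
  assumes wf: "wf_graph G" and reach: "(step (triangle_pds G))\<^sup>*\<^sup>* (q, []) (q', w)"
  shows "int (length w) \<le> 4 * \<lceil>log 2 (real (order G))\<rceil>"
proof (cases "order G < 2")
  case True
  have "edges G = {}"
  proof (rule ccontr)
    assume "edges G \<noteq> {}"
    then obtain e where "e \<in> edges G" by blast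
    then have "e \<subseteq> {..<order G}" "card e = 2" using wf by (auto simp: wf_graph_def)
    then have "2 \<le> order G" by (metis card_lessThan card_mono finite_lessThan)
    with True show False by simp
  qed
  then have "\<not> step (triangle_pds G) (q, []) y" for y
    using step_triangle_pds_iff[OF wf] by (cases y) auto
  with reach have "w = []"
    by (metis converse_rtranclpE prod.inject)
  moreover have "order G = 0 \<or> order G = 1" using True by auto
  ultimately show ?thesis by (auto simp: log_def)
next
  case False
  define n where "n = order G"
  \<comment> \<open>Pushing needs an empty stack and leads to the first copy with two symbols; each
    passage to the next copy removes one.\<close>
  have "length l \<le> 2 \<and> (n \<le> p \<longrightarrow> length l \<le> 1) \<and> (2 * n \<le> p \<longrightarrow> l = [])"
    if "(step (triangle_pds G))\<^sup>*\<^sup>* (q, []) x" "x = (p, l)" for x p l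
    using that
  proof (induction arbitrary: p l rule: rtranclp_induct)
    case (step x y)
    obtain a k where x: "x = (a, k)" by (cases x)
    have IH: "length k \<le> 2 \<and> (n \<le> a \<longrightarrow> length k \<le> 1) \<and> (2 * n \<le> a \<longrightarrow> k = [])"
      using step.IH[OF x] .
    show ?case
      using step.hyps(2) IH wf_graph_edgeD(1,2)[OF wf]
      unfolding x step.prems step_triangle_pds_iff[OF wf] Let_def n_def[symmetric]
      by fastforce
  qed auto
  with reach have "length w \<le> 2" by blast
  moreover have "1 \<le> log 2 (real (order G))" using False by (simp add: le_log_iff)
  then have "1 \<le> \<lceil>log 2 (real (order G))\<rceil>" by linarith
  ultimately show ?thesis by linarith
qed

lemma stack_depth_triangle_pds:
  assumes "wf_graph G"
  shows "stack_depth (triangle_pds G) \<le> enat (nat (4 * \<lceil>log 2 (real (order G))\<rceil>))"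
  unfolding stack_depth_def using reachable_stack_bound[OF assms]
  by (intro Sup_least) (fastforce simp: le_nat_iff)


section \<open>The programs\<close>

text \<open>By induction on the rows: the new row occupies the numbers from \<open>m * n\<close> on,
  with quotient \<open>m\<close> and the column as remainder.\<close>

lemma concat_matrix:
  "concat (map (\<lambda>u. map (f u) [0..<n]) [0..<m]) = map (\<lambda>i. f (i div n) (i mod n)) [0..<m * n]"
proof (induction m)
  case (Suc m)
  have "[0..<Suc m * n] = [0..<m * n] @ map (\<lambda>j. j + m * n) [0..<n]"
    using upt_add_eq_append[of 0 "m * n" n] by (simp add: map_add_upt add.commute[of n])
  then show ?case by (simp add: Suc.IH)
qed simp

lemma graph_code_eq:
  "graph_code G = order G # map (matrix_entry G) [0..<order G * order G]"
  unfolding graph_code_def concat_matrix by (simp add: matrix_entry_def Let_def)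

abbreviation entry_expr :: expr where
  "entry_expr \<equiv> Read 0 (Add (Const 1) (scalar 4))"

abbreviation row_expr :: expr where
  "row_expr \<equiv> Div (scalar 4) (scalar 0)"

abbreviation col_expr :: expr where
  "col_expr \<equiv> Mod (scalar 4) (scalar 0)"

abbreviation triple_order :: expr where
  "triple_order \<equiv> Mul (Const 3) (scalar 0)"

abbreviation num_states :: expr where
  "num_states \<equiv> Add triple_order (Mul (scalar 0) (scalar 0))"

text \<open>The three rules take 6, 4 and 4 words. A matrix entry exceeds its color by one, exactly
  as the code of \<open>Some c\<close> does, so \<open>x\<close> is copied unchanged.\<close>

abbreviation emit_edge :: com where
  "emit_edge \<equiv>
    (let x = entry_expr; c = Sub x (Const 1); n = scalar 0; n2 = Mul (Const 2) n in
     emit [Add triple_order (scalar 4), Const 0, row_expr, Const 2, c, c,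
       row_expr, x, Add n col_expr, Const 0,
       Add n row_expr, x, Add n2 col_expr, Const 0])"

text \<open>Array 4 is the loop counter, array 6 counts the rules and array 7 sums up the entries.\<close>

definition prep_body :: com where
  "prep_body =
    Seq (Cond (Less (Const 0) entry_expr)
          (Seq emit_edge (assign 6 (Add (scalar 6) (Const 3)))) Skip)
      (Seq (assign 7 (Add (scalar 7) entry_expr)) (assign 4 (Add (scalar 4) (Const 1))))"

abbreviation all_pairs :: "com \<Rightarrow> com" where
  "all_pairs c \<equiv> While (Less (scalar 4) (Mul (scalar 0) (scalar 0))) c"

text \<open>Writing starts at address 3. The three header words are filled in last, since the
  alphabet size and the number of rules are known only after the loop.\<close>

definition prep :: com where
  "prep = Seq (assign 5 (Const 3)) (Seq (all_pairs prep_body)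
    (Seq (assign 1 num_states) (Seq (Store 1 (Const 1) (scalar 7)) (Store 1 (Const 2) (scalar 6)))))"

text \<open>Looks up the query \<open>(3 * n + i, 2 * n + v)\<close> in a table whose rows have one
  entry per state.\<close>

definition post_body :: com where
  "post_body =
    Seq (Store 3 (scalar 4) (Read 2 (Add (Mul (Add triple_order (scalar 4)) num_states)
          (Add (Mul (Const 2) (scalar 0)) col_expr))))
      (assign 4 (Add (scalar 4) (Const 1)))"

definition post :: com where
  "post = Seq (assign 4 (Const 0)) (all_pairs post_body)"

section \<open>Loop invariants and step counts\<close>

text \<open>The leading zeros stand for the header still to be filled in. Array 0 is fixed as a
  whole because \<open>post\<close> reads the order from it again.\<close>

definition prep_inv :: "colored_graph \<Rightarrow> nat \<Rightarrow> memory \<Rightarrow> bool" where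
  "prep_inv G i s \<longleftrightarrow> s 0 = input_memory (graph_code G) 0 \<and> s 4 0 = i \<and>
    s 6 0 = length (first_rules G i) \<and> s 7 0 = (\<Sum>j<i. matrix_entry G j) \<and>
    written s ([0, 0, 0] @ concat (map rule_code (first_rules G i)))"

lemma input_memory_graph_code:
  "input_memory (graph_code G) 0 0 = order G"
  "i < order G * order G \<Longrightarrow> input_memory (graph_code G) 0 (Suc i) = matrix_entry G i"
  by (auto simp: input_memory_def graph_code_eq)

lemma length_concat_rule_code:
  "length (concat (map rule_code (first_rules G m))) \<le> 14 * m"
  by (induction m) (auto simp: first_rules_Suc edge_rules_def Let_def)

text \<open>Matches the test of the program, whether the entry is positive, with the presence of
  rules.\<close>

lemma matrix_entry_cases:
  obtains "matrix_entry G i = 0" "edge_rules G i = []"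
  | c where "matrix_entry G i = Suc c"
    "edge_rules G i = [(3 * order G + i, None, i div order G, [c, c]),
      (i div order G, Some c, order G + i mod order G, []),
      (order G + i div order G, Some c, 2 * order G + i mod order G, [])]"
  by (cases "{i div order G, i mod order G} \<in> edges G")
    (auto simp: matrix_entry_def edge_rules_def Let_def)

text \<open>The budget: 29 steps for writing 14 words, one for the rule counter, one for the test
  and two for the closing stores.\<close>

lemma runs_prep_body:
  assumes i: "i < order G * order G" and inv: "prep_inv G i s"
    and B: "3 + 14 * (order G * order G) < B" "(\<Sum>j<order G * order G. matrix_entry G j) < B"
  shows "runs B prep_body s 33 (prep_inv G (Suc i))"
proof -
  define n where "n = order G"
  define u where "u = i div n"
  define v where "v = i mod n"
  define ys where "ys = [0, 0, 0] @ concat (map rule_code (first_rules G i))"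
  note uv = pair_of_number[OF i, folded n_def, folded u_def v_def]
  have nn: "n \<le> n * n" by simp
  have s: "s 0 0 = n" "s 0 (Suc i) = matrix_entry G i" "s 4 0 = i"
    "s 6 0 = length (first_rules G i)" "s 7 0 = (\<Sum>j<i. matrix_entry G j)" "written s ys"
    using inv i by (simp_all add: prep_inv_def input_memory_graph_code n_def ys_def)
  \<comment> \<open>This bounds the accumulator in array 7 and also the current entry, hence the
    color written as a symbol.\<close>
  have sum: "(\<Sum>j<i. matrix_entry G j) + matrix_entry G i < B"
  proof -
    have "(\<Sum>j<Suc i. matrix_entry G j) \<le> (\<Sum>j<order G * order G. matrix_entry G j)"
      using i by (intro sum_mono2) auto
    with B(2) show ?thesis by simp
  qed
  have len: "length ys + 14 < B" "length (first_rules G i) + 3 < B" "i + 1 < B"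
    using length_concat_rule_code[of G i] length_first_rules_le[of G i] i B(1)
    by (simp_all add: ys_def)
  have "runs B (Cond (Less (Const 0) entry_expr)
      (Seq emit_edge (assign 6 (Add (scalar 6) (Const 3)))) Skip) s 31
    (\<lambda>s'. s' 0 = s 0 \<and> s' 4 = s 4 \<and> s' 7 = s 7 \<and> s' 6 0 = length (first_rules G (Suc i)) \<and>
      written s' (ys @ concat (map rule_code (edge_rules G i))))" (is "runs _ _ _ _ ?Q")
  proof (cases rule: matrix_entry_cases[of G i])
    case 1
    then show ?thesis
      using s by (intro runs_Cond[where T = 1] runs_Skip) (auto simp: first_rules_Suc)
  next
    case (2 c)
    define xs where "xs = concat (map rule_code (edge_rules G i))"
    have len3: "length (edge_rules G i) = 3"
      using 2 by simp
    have xs: "xs = [3 * n + i, 0, u, 2, c, c, u, Suc c, n + v, 0, n + u, Suc c, 2 * n + v, 0]"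
      using 2 by (simp add: xs_def n_def u_def v_def)
    have "2 < B" "c < B" "Suc c < B" "3 * n + i < B" "2 * n + v < B" "n + u < B"
      using uv nn B(1) sum 2(1) i unfolding n_def by linarith+
    then have xsB: "\<forall>x \<in> set xs. x < B"
      using uv by (auto simp: xs)
    have emit: "runs B emit_edge s 29
      (\<lambda>s'. written s' (ys @ xs) \<and> (\<forall>a. a \<noteq> 1 \<longrightarrow> a \<noteq> 5 \<longrightarrow> s' a = s a))"
      unfolding Let_def
      by (rule runs_mono[OF runs_emit[OF s(6) _ xsB]])
        (use len 2 in \<open>auto simp: xs s u_def v_def\<close>)
    have "runs B (Seq emit_edge (assign 6 (Add (scalar 6) (Const 3)))) s 30 ?Q"
    proof (rule runs_Seq[where U = 1], rule runs_mono[OF emit order_refl])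
      fix s' assume s': "written s' (ys @ xs) \<and> (\<forall>a. a \<noteq> 1 \<longrightarrow> a \<noteq> 5 \<longrightarrow> s' a = s a)"
      then show "runs B (assign 6 (Add (scalar 6) (Const 3))) s' 1 ?Q"
        using len s by (intro runs_Store) (auto simp: first_rules_Suc len3 xs_def[symmetric] written_def)
    qed simp
    then show ?thesis
      using 2 s by (intro runs_Cond[where T = 30]) auto
  qed
  then show ?thesis
    unfolding prep_body_def
  proof (rule runs_Seq[where U = 2, OF runs_mono[OF _ order_refl]])
    fix s' assume s': "?Q s'"
    show "runs B (Seq (assign 7 (Add (scalar 7) entry_expr)) (assign 4 (Add (scalar 4) (Const 1))))
      s' 2 (prep_inv G (Suc i))"
      using s' s sum len inv
      by (intro runs_Seq[where T = 1 and U = 1] runs_Store)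
        (auto simp: prep_inv_def written_def ys_def first_rules_Suc)
  qed simp
qed

lemma runs_prep:
  assumes B: "3 + 14 * (order G * order G) < B" "(\<Sum>j<order G * order G. matrix_entry G j) < B"
  shows "runs B prep (input_memory (graph_code G)) (34 * (order G * order G) + 5)
    (\<lambda>s. s 0 = input_memory (graph_code G) 0 \<and>
      (\<exists>ys. pds_code (triangle_pds G) ys \<and> holds_list (s 1) ys))"
proof -
  define N where "N = order G * order G"
  define s0 where "s0 = input_memory (graph_code G)"
  define rs where "rs = first_rules G N"
  define s1 where "s1 = s0(5 := (s0 5)(0 := 3))"
  \<comment> \<open>Memory outside array 0 is zero-initialised, so the counters and the header
    placeholders are already in place.\<close>
  have inv0: "prep_inv G 0 s1"
    by (auto simp: prep_inv_def s1_def s0_def input_memory_def written_def holds_list_def nth_Cons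
        split: nat.splits)
  have loop: "runs B (all_pairs prep_body) s1 ((N - 0) * Suc 33 + 1) (prep_inv G N)"
  proof (rule runs_While[where Inv = "prep_inv G", OF le0 inv0])
    show "test_holds (Less (scalar 4) (Mul (scalar 0) (scalar 0))) s \<and>
        runs B prep_body s 33 (prep_inv G (Suc j))" if "j < N" "prep_inv G j s" for j s
      using runs_prep_body[OF _ that(2) B] that
      by (auto simp: N_def prep_inv_def input_memory_graph_code)
  qed (auto simp: N_def prep_inv_def input_memory_graph_code)
  define ys where "ys = [3 * order G + N, \<Sum>j<N. matrix_entry G j, length rs] @ concat (map rule_code rs)"
  have code: "pds_code (triangle_pds G) ys"
    unfolding pds_code_def
    by (rule exI[of _ rs]) (auto simp: ys_def rs_def N_def distinct_first_rules)
  have Bs: "2 < B" "3 * order G + N < B" "length rs < B"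
    using B(1) length_first_rules_le[of G N] le_square[of "order G"] unfolding N_def rs_def by linarith+
  have fin: "runs B (Seq (assign 1 num_states)
        (Seq (Store 1 (Const 1) (scalar 7)) (Store 1 (Const 2) (scalar 6)))) s 3
      (\<lambda>s. s 0 = s0 0 \<and> holds_list (s 1) ys)" if "prep_inv G N s" for s
  proof -
    have s: "s 0 = s0 0" "s 0 0 = order G" "s 6 0 = length rs" "s 7 0 = (\<Sum>j<N. matrix_entry G j)"
      "holds_list (s 1) ([0, 0, 0] @ concat (map rule_code rs))"
      using that by (simp_all add: prep_inv_def s0_def rs_def written_def input_memory_graph_code)
    have "holds_list ((s 1)(0 := 3 * order G + N, 1 := \<Sum>j<N. matrix_entry G j, 2 := length rs)) ys"
      using s(5) by (auto simp: holds_list_def ys_def nth_Cons split: nat.splits)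
    then show ?thesis
      using s Bs B(2)
      by (intro runs_Seq[where T = 1 and U = 2] runs_Seq[where T = 1 and U = 1] runs_Store)
        (auto simp: N_def numeral_2_eq_2)
  qed
  have rest: "runs B (Seq (all_pairs prep_body) (Seq (assign 1 num_states)
        (Seq (Store 1 (Const 1) (scalar 7)) (Store 1 (Const 2) (scalar 6))))) s1 (34 * N + 4)
      (\<lambda>s. s 0 = s0 0 \<and> holds_list (s 1) ys)"
    by (rule runs_Seq[OF runs_mono[OF loop order_refl fin]]) auto
  have "runs B prep s0 (34 * N + 5) (\<lambda>s. s 0 = s0 0 \<and> holds_list (s 1) ys)"
    unfolding prep_def
    by (rule runs_Seq[where T = 1 and U = "34 * N + 4", OF runs_Store])
      (use rest B(1) in \<open>auto simp: s1_def\<close>)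
  then show ?thesis
    unfolding N_def s0_def by (rule runs_mono) (use code in auto)
qed

lemma runs_post:
  assumes wf: "wf_graph G" and n: "s 0 0 = order G" and B: "order G * order G < B" "1 < B"
    and table: "answer_table (sparse_pds_reachability K) (triangle_pds G) (s 2)"
  shows "runs B post s (3 * (order G * order G) + 2) (\<lambda>s'. answer_table ae_mono_triangle G (s' 3))"
proof -
  define n where "n = order G"
  define P where "P = triangle_pds G"
  define Inv where "Inv i s' \<longleftrightarrow> s' 0 0 = n \<and> s' 2 = s 2 \<and> s' 4 0 = i \<and>
    (\<forall>j<i. s' 3 j = of_bool (state_reachable P (3 * n + j, 2 * n + j mod n)))" for i and s' :: memory
  \<comment> \<open>Both components are state numbers, so the supplied table answers this
    query.\<close>
  have ans: "s 2 ((3 * n + i) * (3 * n + n * n) + (2 * n + i mod n)) =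
      of_bool (state_reachable P (3 * n + i, 2 * n + i mod n))" if "i < n * n" for i
  proof -
    have "(3 * n + i, 2 * n + i mod n) \<in> states P \<times> states P"
      using that pair_of_number[OF that] by (auto simp: P_def n_def[symmetric] trans_less_add1)
    with table show ?thesis
      unfolding answer_table_def sparse_pds_reachability_def P_def[symmetric]
      by (fastforce simp: P_def n_def)
  qed
  have "runs B (all_pairs post_body) (s(4 := (s 4)(0 := 0))) ((n * n - 0) * Suc 2 + 1) (Inv (n * n))"
  proof (rule runs_While)
    show "test_holds (Less (scalar 4) (Mul (scalar 0) (scalar 0))) s' \<and>
        runs B post_body s' 2 (Inv (Suc i))" if i: "i < n * n" and "Inv i s'" for i s'
    proof
      have s': "s' 0 0 = n" "s' 2 = s 2" "s' 4 0 = i"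
        "\<forall>j<i. s' 3 j = of_bool (state_reachable P (3 * n + j, 2 * n + j mod n))"
        using \<open>Inv i s'\<close> by (auto simp: Inv_def)
      then show "test_holds (Less (scalar 4) (Mul (scalar 0) (scalar 0))) s'"
        using i by simp
      show "runs B post_body s' 2 (Inv (Suc i))"
        unfolding post_body_def using s' ans[OF i] i B
        by (intro runs_Seq[where T = 1 and U = 1] runs_Store)
          (auto simp: Inv_def less_Suc_eq n_def[symmetric])
    qed
  qed (auto simp: Inv_def n n_def)
  then have "runs B (all_pairs post_body) (s(4 := (s 4)(0 := 0))) (3 * (n * n) + 1)
      (\<lambda>s'. answer_table ae_mono_triangle G (s' 3))"
  proof (rule runs_mono)
    fix s' assume inv: "Inv (n * n) s'"
    have "s' 3 (u * n + v) = of_bool (in_mono_triangle G (u, v))" if e: "{u, v} \<in> edges G" for u v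
    proof -
      note uv = wf_graph_edgeD(1,2)[OF wf e, folded n_def]
      have "s' 3 (u * n + v) = of_bool (state_reachable P (3 * n + (u * n + v), 2 * n + v))"
        using inv pair_number_less[OF uv] uv by (simp add: Inv_def)
      then show ?thesis
        using sound_triangle_pds[OF wf e] complete_triangle_pds[OF wf e]
        by (auto simp: P_def n_def)
    qed
    then show "answer_table ae_mono_triangle G (s' 3)"
      by (auto simp: answer_table_def ae_mono_triangle_def n_def)
  qed simp
  then show ?thesis
    unfolding post_def using B
    by (intro runs_Seq[where T = 1 and U = "3 * (n * n) + 1"] runs_Store) (auto simp: n_def)
qed

section \<open>Word size and the whole reduction\<close>

text \<open>With base \<open>b = 3 + N + M\<close>, the fourth power is at least
  \<open>27 * b\<close>, which covers all addresses. It is also at least \<open>b * b\<close>, which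
  exceeds \<open>N * M\<close> and thus the sum of the \<open>N\<close> entries.\<close>

lemma word_bound_graph_code:
  fixes G :: colored_graph
  defines "B \<equiv> word_bound 4 (graph_code G)"
  shows "3 + 14 * (order G * order G) < B" "(\<Sum>j<order G * order G. matrix_entry G j) < B"
proof -
  define N where "N = order G * order G"
  define M where "M = Max (insert 0 (set (graph_code G)))"
  define b where "b = 2 + length (graph_code G) + M"
  have B: "B = b ^ 4"
    by (simp add: B_def word_bound_def b_def M_def)
  have b_def: "b = 3 + N + M"
    by (simp add: b_def N_def graph_code_eq)
  have "27 * b \<le> b ^ 3 * b"
    using power_mono[of 3 b 3] by (intro mult_right_mono) (auto simp: b_def)
  then have "27 * b \<le> B"
    unfolding B by (simp add: eval_nat_numeral algebra_simps)
  then show "3 + 14 * (order G * order G) < B"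
    by (simp add: b_def N_def)
  have "(\<Sum>j<N. matrix_entry G j) \<le> N * M"
    using sum_bounded_above[of "{..<N}" "matrix_entry G" M]
    by (auto simp: M_def graph_code_eq N_def intro!: Max_ge)
  also have "\<dots> < b * b"
    by (rule mult_strict_mono) (auto simp: b_def)
  also have "\<dots> \<le> b ^ 4"
    using power_increasing[of 2 4 b] by (simp add: b_def power2_eq_square)
  finally show "(\<Sum>j<order G * order G. matrix_entry G j) < B"
    by (simp add: B N_def)
qed

lemma computes_reduction_triangle_pds:
  "computes_reduction prep post 4 ae_mono_triangle (sparse_pds_reachability K) triangle_pds
    (\<lambda>G. 37 * (order G * order G) + 7)"
  unfolding computes_reduction_def
proof (intro ballI allI impI)
  fix G xs
  assume "G \<in> instances ae_mono_triangle" "codes ae_mono_triangle G xs"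
  then have wf: "wf_graph G" and xs: "xs = graph_code G"
    by (auto simp: ae_mono_triangle_def)
  define B where "B = word_bound 4 (graph_code G)"
  note bounds = word_bound_graph_code[of G, folded B_def]
  obtain t s ys where s: "exec B prep (input_memory xs) t s" "t \<le> 34 * (order G * order G) + 5"
    "s 0 = input_memory (graph_code G) 0" "pds_code (triangle_pds G) ys" "holds_list (s 1) ys"
    using runs_prep[OF bounds] unfolding runs_def xs by blast
  have "\<exists>t' s'. exec B post (s(2 := m)) t' s' \<and> answer_table ae_mono_triangle G (s' 3) \<and>
      t + t' \<le> 37 * (order G * order G) + 7"
    if "answer_table (sparse_pds_reachability K) (triangle_pds G) m" for m
  proof -
    \<comment> \<open>Supplying the answers changes array 2 only, so the order is still found in
      array 0.\<close>
    have "runs B post (s(2 := m)) (3 * (order G * order G) + 2)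
        (\<lambda>s'. answer_table ae_mono_triangle G (s' 3))"
      using wf that bounds(1) by (intro runs_post) (auto simp: s(3) input_memory_graph_code)
    then show ?thesis
      unfolding runs_def using s(2) by fastforce
  qed
  then show "\<exists>t s ys. exec (word_bound 4 xs) prep (input_memory xs) t s \<and>
      codes (sparse_pds_reachability K) (triangle_pds G) ys \<and> holds_list (s 1) ys \<and>
      (\<forall>m. answer_table (sparse_pds_reachability K) (triangle_pds G) m \<longrightarrow>
        (\<exists>t' s'. exec (word_bound 4 xs) post (s(2 := m)) t' s' \<and>
          answer_table ae_mono_triangle G (s' 3) \<and> t + t' \<le> 37 * (order G * order G) + 7))"
    using s(1,4,5) unfolding B_def xs
    by (intro exI[of _ t] exI[of _ s] exI[of _ ys]) (simp add: sparse_pds_reachability_def)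
qed

section \<open>Asymptotic bounds and conclusion\<close>

lemma eventually_growing_ge:
  "eventually (\<lambda>I. m \<le> inst_size P I) (growing P)"
  unfolding growing_def
  by (rule filter_leD[OF inf_le1]) (auto simp: eventually_filtercomap intro: eventually_ge_at_top)

text \<open>For \<open>n \<ge> 1\<close> the number of states lies between \<open>n * n\<close> and
  \<open>4 * (n * n)\<close>, and twice \<open>5 / 4\<close> is \<open>5 / 2\<close>. As
  \<open>e\<close> may exceed 1, the exponent \<open>p\<close> may be negative; then the lower bound
  is the relevant one, with constant 1.\<close>

lemma size_bound_triangle_pds:
  "(\<lambda>G. (real (card (states (triangle_pds G))) powr (5 / 4)) powr (1 - e))
    \<in> O[growing ae_mono_triangle](\<lambda>G. (real (order G) powr (5 / 2)) powr (1 - e))"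
proof (rule bigoI)
  define p where "p = 5 / 4 * (1 - e)"
  show "eventually (\<lambda>G. norm ((real (card (states (triangle_pds G))) powr (5 / 4)) powr (1 - e))
      \<le> max 1 (4 powr p) * norm ((real (order G) powr (5 / 2)) powr (1 - e))) (growing ae_mono_triangle)"
    using eventually_growing_ge[of 1 ae_mono_triangle]
  proof eventually_elim
    case (elim G)
    define n where "n = real (order G)"
    have n: "1 \<le> n" using elim by (simp add: n_def ae_mono_triangle_def)
    then have nn: "n \<le> n * n" by simp
    have "(3 * n + n * n) powr p \<le> max 1 (4 powr p) * (n * n) powr p"
    proof (cases "0 \<le> p")
      case True
      then have "(3 * n + n * n) powr p \<le> (4 * (n * n)) powr p"
        using n nn by (intro powr_mono2) auto
      also have "\<dots> = 4 powr p * (n * n) powr p"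
        by (rule powr_mult)
      also have "\<dots> \<le> max 1 (4 powr p) * (n * n) powr p"
        by (intro mult_right_mono) auto
      finally show ?thesis .
    next
      case False
      then have "(3 * n + n * n) powr p \<le> 1 * (n * n) powr p"
        using n by (simp add: powr_mono2')
      also have "\<dots> \<le> max 1 (4 powr p) * (n * n) powr p"
        by (intro mult_right_mono) auto
      finally show ?thesis .
    qed
    moreover have "n * n = n powr 2"
      using n by (simp add: powr_numeral power2_eq_square)
    moreover have "2 * p = 5 / 2 * (1 - e)"
      by (simp add: p_def)
    ultimately have "(3 * n + n * n) powr p \<le> max 1 (4 powr p) * n powr (5 / 2 * (1 - e))"
      by (metis powr_powr)
    then have "((3 * n + n * n) powr (5 / 4)) powr (1 - e)
        \<le> max 1 (4 powr p) * (n powr (5 / 2)) powr (1 - e)"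
      unfolding powr_powr p_def .
    then show ?case
      by (simp add: n_def)
  qed
qed

text \<open>The saving \<open>1 / 5\<close> is exact for quadratic time, as
  \<open>5 / 2 * (4 / 5) = 2\<close>; the constant is \<open>37 + 7\<close>.\<close>

lemma time_bound_triangle_pds:
  "(\<lambda>G. real (37 * (order G * order G) + 7))
    \<in> O[growing ae_mono_triangle](\<lambda>G. (real (order G) powr (5 / 2)) powr (1 - 1 / 5))"
proof (rule bigoI)
  show "eventually (\<lambda>G. norm (real (37 * (order G * order G) + 7))
      \<le> 44 * norm ((real (order G) powr (5 / 2)) powr (1 - 1 / 5))) (growing ae_mono_triangle)"
    using eventually_growing_ge[of 1 ae_mono_triangle]
  proof eventually_elim
    case (elim G)
    then have n: "1 \<le> real (order G)" by (simp add: ae_mono_triangle_def)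
    then have "1 \<le> real (order G) * real (order G)"
      using mult_mono[of 1 "real (order G)" 1 "real (order G)"] by simp
    with n show ?case
      by (simp add: powr_powr powr_numeral power2_eq_square)
  qed
qed

text \<open>Every pair of vertices contributes at most three rules and owns a state, whence sparsity
  constant 3.\<close>

lemma triangle_pds_instance:
  assumes "wf_graph G"
  shows "triangle_pds G \<in> instances (sparse_pds_reachability 3)"
proof -
  have "card (rules (triangle_pds G)) \<le> 3 * (order G * order G)"
    using card_length[of "first_rules G (order G * order G)"] length_first_rules_le[of G]
    by (auto intro: le_trans)
  then show ?thesis
    using wf_triangle_pds[OF assms] by (simp add: sparse_pds_reachability_def sparse_def)
qed

theorem theorem6:
  "\<exists>K f. fine_grained_reduction
       ae_mono_triangle (\<lambda>n. real n powr (5 / 2))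
       (sparse_pds_reachability K) (\<lambda>N. real N powr (5 / 4)) f \<and>
     (\<forall>G \<in> instances ae_mono_triangle.
       stack_depth (f G) \<le> enat (nat (4 * \<lceil>log 2 (real (order G))\<rceil>)))"
proof (intro exI[of _ 3] exI[of _ triangle_pds] conjI ballI)
  have sizes: "inst_size ae_mono_triangle = order"
    "inst_size (sparse_pds_reachability 3) = (\<lambda>P. card (states P))"
    by (simp_all add: ae_mono_triangle_def sparse_pds_reachability_def)
  show "fine_grained_reduction ae_mono_triangle (\<lambda>n. real n powr (5 / 2))
      (sparse_pds_reachability 3) (\<lambda>N. real N powr (5 / 4)) triangle_pds"
    unfolding fine_grained_reduction_def sizes
  proof (intro conjI ballI allI impI)
    show "triangle_pds G \<in> instances (sparse_pds_reachability 3)"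
      if "G \<in> instances ae_mono_triangle" for G
      using that by (simp add: ae_mono_triangle_def triangle_pds_instance)
    show "\<exists>\<delta>>0. (\<lambda>G. (real (card (states (triangle_pds G))) powr (5 / 4)) powr (1 - \<epsilon>))
        \<in> O[growing ae_mono_triangle](\<lambda>G. (real (order G) powr (5 / 2)) powr (1 - \<delta>))"
      if "\<epsilon> > 0" for \<epsilon> :: real
      \<comment> \<open>Here \<open>\<delta> = \<epsilon>\<close> works, because the two time bounds
        agree up to a constant factor.\<close>
      using that size_bound_triangle_pds by blast
    show "\<exists>prep post k time. \<exists>\<gamma>>0.
        computes_reduction prep post k ae_mono_triangle (sparse_pds_reachability 3) triangle_pds time \<and>
        (\<lambda>G. real (time G)) \<in> O[growing ae_mono_triangle](\<lambda>G. (real (order G) powr (5 / 2)) powr (1 - \<gamma>))"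
      by (rule exI[of _ prep], rule exI[of _ post], rule exI[of _ 4],
          rule exI[of _ "\<lambda>G. 37 * (order G * order G) + 7"], rule exI[of _ "1 / 5"])
        (intro conjI computes_reduction_triangle_pds time_bound_triangle_pds, simp)
  qed
  show "stack_depth (triangle_pds G) \<le> enat (nat (4 * \<lceil>log 2 (real (order G))\<rceil>))"
    if "G \<in> instances ae_mono_triangle" for G
    using that by (simp add: ae_mono_triangle_def stack_depth_triangle_pds)
qed

end
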